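(* Let $(\varphi_j)_{j\ge 0}$ be non-negative numbers with $\varphi_0>0$. For $n\ge1$ let $T_n=\sum_{T\in\mathcal{O}(n)} \Big(\prod_{v\in T}\varphi_{\mathrm{outdeg}(v)}\Big)\,\ell(T)$, where $\ell(T)$ is the number of increasing bilabellings of $T$ with label set $\{1,\dots,2n\}$. Then \[\sum_{T\in\mathcal{O}(n)}\prod_{v\in T}\left(\frac{\varphi_{\mathrm{outdeg}(v)}}{2h_v(2h_v-1)}\right)=\frac{T_n}{(2n)!}.\]
   Context: $\mathcal{O}(n)$ denotes the set of ordered (planted plane) rooted trees with $n$ nodes; $\mathrm{outdeg}(v)$ is the number of children of $v$. The hook-length $h_v$ of a node $v$ is the number of descendants of $v$ including $v$ itself (the size of the subtree rooted at $v$). An increasing bilabelling of a tree with $n$ nodes assigns to each node a set of exactly two integers from $\{1,\dots,2n\}$, these sets partitioning $\{1,\dots,2n\}$, such that every label of a child is larger than both labels of its parent. *)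

theory Defs
  imports Complex_Main "HOL-Library.FuncSet" "HOL-Library.Sublist" "HOL-Library.Disjoint_Sets"
begin

text \<open>
  A node of an ordered rooted tree is identified with the list of child indices on the path
  leading from the root to it: the root is \<open>[]\<close> and the children of \<open>v\<close> are the nodes of
  the form \<open>v @ [i]\<close>.
\<close>

datatype otree = Node "otree list"

fun is_node :: "otree \<Rightarrow> nat list \<Rightarrow> bool" where
  "is_node t [] \<longleftrightarrow> True"
| "is_node (Node ts) (i # p) \<longleftrightarrow> i < length ts \<and> is_node (ts ! i) p"

definition nodes :: "otree \<Rightarrow> nat list set" where
  "nodes t = {v. is_node t v}"

definition ordered_trees :: "nat \<Rightarrow> otree set" where
  "ordered_trees n = {t. card (nodes t) = n}"

definition children :: "otree \<Rightarrow> nat list \<Rightarrow> nat list set" where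
  "children t v = {w \<in> nodes t. \<exists>i. w = v @ [i]}"

definition outdeg :: "otree \<Rightarrow> nat list \<Rightarrow> nat" where
  "outdeg t v = card (children t v)"

definition hook_length :: "otree \<Rightarrow> nat list \<Rightarrow> nat" where
  "hook_length t v = card {w \<in> nodes t. prefix v w}"

text \<open>
  Bilabellings are extensional functions on the nodes, so that each one is counted once.
\<close>

definition increasing_bilabellings :: "otree \<Rightarrow> (nat list \<Rightarrow> nat set) set" where
  "increasing_bilabellings t = {L \<in> extensional (nodes t).
     (\<forall>v\<in>nodes t. card (L v) = 2) \<and>
     disjoint_family_on L (nodes t) \<and>
     (\<Union>v\<in>nodes t. L v) = {1..2 * card (nodes t)} \<and>
     (\<forall>v\<in>nodes t. \<forall>w\<in>children t v. \<forall>a\<in>L v. \<forall>b\<in>L w. a < b)}"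

definition bilabelled_weight :: "(nat \<Rightarrow> real) \<Rightarrow> nat \<Rightarrow> real" where
  "bilabelled_weight \<phi> n =
     (\<Sum>t\<in>ordered_trees n. (\<Prod>v\<in>nodes t. \<phi> (outdeg t v)) * real (card (increasing_bilabellings t)))"

text \<open>
  The following finiteness facts ensure that the cardinalities, sums and products above and
  in the hook-length formula range over finite sets.
\<close>

lemma nodes_Node: "nodes (Node ts) = insert [] (\<Union>i<length ts. (#) i ` nodes (ts ! i))"
proof (rule set_eqI)
  fix v show "v \<in> nodes (Node ts) \<longleftrightarrow> v \<in> insert [] (\<Union>i<length ts. (#) i ` nodes (ts ! i))"
    by (cases v) (auto simp: nodes_def)
qed

lemma finite_nodes: "finite (nodes t)"
proof (induction t)
  case (Node ts)
  have "finite (nodes (ts ! i))" if "i < length ts" for i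
    using Node that by simp
  thus ?case unfolding nodes_Node by blast
qed

lemma card_nodes_Node: "card (nodes (Node ts)) = Suc (\<Sum>i<length ts. card (nodes (ts ! i)))"
proof -
  have "card (\<Union>i<length ts. (#) i ` nodes (ts ! i)) = (\<Sum>i<length ts. card ((#) i ` nodes (ts ! i)))"
    by (rule card_UN_disjoint) (auto simp: finite_nodes)
  also have "\<dots> = (\<Sum>i<length ts. card (nodes (ts ! i)))"
    by (intro sum.cong card_image) (auto simp: inj_on_def)
  finally show ?thesis
    unfolding nodes_Node by (subst card_insert_disjoint) (auto simp: finite_nodes)
qed

lemma card_nodes_pos: "card (nodes t) > 0"
  by (cases t) (simp add: card_nodes_Node)

lemma finite_trees_le: "finite {t. card (nodes t) \<le> n}"
proof (induction n)
  case 0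
  have "{t. card (nodes t) \<le> 0} = {}"
    using card_nodes_pos by (auto simp only: not_le[symmetric])
  then show ?case by (simp only: finite.emptyI)
next
  case (Suc n)
  let ?A = "{t. card (nodes t) \<le> n}"
  have "{t. card (nodes t) \<le> Suc n} \<subseteq> Node ` {ts. set ts \<subseteq> ?A \<and> length ts \<le> n}"
  proof
    fix t assume "t \<in> {t. card (nodes t) \<le> Suc n}"
    moreover obtain ts where t: "t = Node ts" by (cases t)
    ultimately have le: "(\<Sum>i<length ts. card (nodes (ts ! i))) \<le> n"
      by (simp add: card_nodes_Node)
    have "card (nodes (ts ! i)) \<le> n" if "i < length ts" for i
      using member_le_sum[of i "{..<length ts}" "\<lambda>i. card (nodes (ts ! i))"] that le by simp
    hence "set ts \<subseteq> ?A" by (auto simp: in_set_conv_nth)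
    moreover have "(\<Sum>i<length ts. 1) \<le> (\<Sum>i<length ts. card (nodes (ts ! i)))"
      by (rule sum_mono) (simp add: Suc_leI card_nodes_pos)
    hence "length ts \<le> n" using le by simp
    ultimately show "t \<in> Node ` {ts. set ts \<subseteq> ?A \<and> length ts \<le> n}" by (simp add: t)
  qed
  thus ?case
    by (rule finite_subset) (intro finite_imageI finite_lists_length_le Suc.IH)
qed

lemma finite_ordered_trees: "finite (ordered_trees n)"
  by (rule finite_subset[OF _ finite_trees_le[of n]]) (auto simp: ordered_trees_def)

lemma finite_increasing_bilabellings: "finite (increasing_bilabellings t)"
proof (rule finite_subset)
  show "increasing_bilabellings t \<subseteq> (nodes t \<rightarrow>\<^sub>E Pow {1..2 * card (nodes t)})"
  proof
    fix L assume "L \<in> increasing_bilabellings t"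
    hence ext: "L \<in> extensional (nodes t)" and un: "(\<Union>v\<in>nodes t. L v) = {1..2 * card (nodes t)}"
      unfolding increasing_bilabellings_def by blast+
    have "L v \<in> Pow {1..2 * card (nodes t)}" if "v \<in> nodes t" for v
      unfolding un[symmetric] using that by blast
    thus "L \<in> nodes t \<rightarrow>\<^sub>E Pow {1..2 * card (nodes t)}"
      using ext unfolding PiE_def Pi_def by blast
  qed
  show "finite (nodes t \<rightarrow>\<^sub>E Pow {1..2 * card (nodes t)})"
    by (intro finite_PiE finite_nodes) auto
qed

end

theory Submission
  imports Defs
begin

text \<open>
  It suffices to show that a single tree \<open>t\<close> with \<open>n\<close> nodes satisfies
  \<open>\<ell>(t) * (\<Prod>v. 2 * h v * (2 * h v - 1)) = (2 * n)!\<close>. This holds more generally for every finite set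
  of lists ordered by the prefix relation, which is always a forest order. Split off
  a shortest element \<open>r\<close> together with everything above it. If other elements remain, the two
  parts are incomparable and the labels are distributed among them in a binomial number of ways.
  Otherwise \<open>r\<close> is a root, it must carry the two smallest labels, and deleting it
  removes the factor \<open>2 * n * (2 * n - 1)\<close>.
\<close>

section \<open>Bilabellings and hook products of sets of lists\<close>

text \<open>The order condition ranges over all prefix-related pairs, not only over edges, because
  an arbitrary \<open>V\<close> may lack the lists lying between two of its elements. The label set
  \<open>A\<close> is free because the parts of a split receive labels that need not form an
  interval.\<close>

definition bilabellings :: "'a list set \<Rightarrow> nat set \<Rightarrow> ('a list \<Rightarrow> nat set) set" where
  "bilabellings V A = {L \<in> extensional V.
     (\<forall>v\<in>V. card (L v) = 2) \<and>
     disjoint_family_on L V \<and>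
     (\<Union>v\<in>V. L v) = A \<and>
     (\<forall>v\<in>V. \<forall>w\<in>V. strict_prefix v w \<longrightarrow> (\<forall>a\<in>L v. \<forall>b\<in>L w. a < b))}"

text \<open>For finite \<open>V\<close> the natural subtraction never truncates: each
  \<open>v\<close> is counted in its own hook.\<close>

definition hook_product :: "'a list set \<Rightarrow> nat" where
  "hook_product V =
     (\<Prod>v\<in>V. 2 * card {w \<in> V. prefix v w} * (2 * card {w \<in> V. prefix v w} - 1))"

lemma bilabellingsI:
  assumes "L \<in> extensional V" "\<And>v. v \<in> V \<Longrightarrow> card (L v) = 2"
    "\<And>v w. v \<in> V \<Longrightarrow> w \<in> V \<Longrightarrow> v \<noteq> w \<Longrightarrow> L v \<inter> L w = {}"
    "(\<Union>v\<in>V. L v) = A"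
    "\<And>v w a b. v \<in> V \<Longrightarrow> w \<in> V \<Longrightarrow> strict_prefix v w \<Longrightarrow> a \<in> L v \<Longrightarrow> b \<in> L w \<Longrightarrow> a < b"
  shows "L \<in> bilabellings V A"
  using assms unfolding bilabellings_def disjoint_family_on_def by blast

lemma bilabellingsD:
  assumes "L \<in> bilabellings V A"
  shows "L \<in> extensional V" "\<And>v. v \<in> V \<Longrightarrow> card (L v) = 2"
    "\<And>v w. v \<in> V \<Longrightarrow> w \<in> V \<Longrightarrow> v \<noteq> w \<Longrightarrow> L v \<inter> L w = {}"
    "(\<Union>v\<in>V. L v) = A"
    "\<And>v w a b. v \<in> V \<Longrightarrow> w \<in> V \<Longrightarrow> strict_prefix v w \<Longrightarrow> a \<in> L v \<Longrightarrow> b \<in> L w \<Longrightarrow> a < b"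
  using assms unfolding bilabellings_def disjoint_family_on_def by blast+

lemma finite_bilabellings:
  assumes "finite V" "finite A"
  shows "finite (bilabellings V A)"
proof (rule finite_subset)
  show "bilabellings V A \<subseteq> (V \<rightarrow>\<^sub>E Pow A)"
    by (auto simp: bilabellings_def PiE_def)
  show "finite (V \<rightarrow>\<^sub>E Pow A)"
    using assms by (intro finite_PiE) auto
qed

lemma card_label_set:
  assumes "L \<in> bilabellings V A" "finite V" "W \<subseteq> V"
  shows "card (\<Union>v\<in>W. L v) = 2 * card W"
proof -
  have "card (\<Union>v\<in>W. L v) = (\<Sum>v\<in>W. card (L v))"
  proof (rule card_UN_disjoint)
    show "finite W" using assms finite_subset by blast
    show "\<forall>v\<in>W. finite (L v)"
    proof
      fix v assume "v \<in> W"
      then have "card (L v) = 2" using bilabellingsD(2)[OF assms(1)] assms(3) by auto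
      \<comment> \<open>An infinite set has cardinality 0 by convention, so cardinality 2 implies
        finiteness.\<close>
      then show "finite (L v)" using card.infinite by fastforce
    qed
    show "\<forall>v\<in>W. \<forall>w\<in>W. v \<noteq> w \<longrightarrow> L v \<inter> L w = {}"
      using bilabellingsD(3)[OF assms(1)] assms(3) by blast
  qed
  also have "\<dots> = (\<Sum>v\<in>W. 2)"
    using bilabellingsD(2)[OF assms(1)] assms(3) by (intro sum.cong) auto
  finally show ?thesis by simp
qed

lemma restrict_bilabelling:
  assumes L: "L \<in> bilabellings V A" and W: "W \<subseteq> V"
  shows "restrict L W \<in> bilabellings W (\<Union>v\<in>W. L v)"
proof (rule bilabellingsI)
  show "restrict L W \<in> extensional W" by simp
  show "card (restrict L W v) = 2" if "v \<in> W" for v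
    using that W bilabellingsD(2)[OF L] by auto
  show "restrict L W v \<inter> restrict L W w = {}" if "v \<in> W" "w \<in> W" "v \<noteq> w" for v w
    using that W bilabellingsD(3)[OF L, of v w] by auto
  show "a < b" if "v \<in> W" "w \<in> W" "strict_prefix v w" "a \<in> restrict L W v" "b \<in> restrict L W w"
    for v w a b
    using that W bilabellingsD(5)[OF L, of v w a b] by auto
qed simp

section \<open>Splitting into two incomparable parts\<close>

text \<open>No order condition links the two parts, so once the set \<open>C\<close> of labels used
  on \<open>V\<close> is fixed, both parts are labelled independently.\<close>

lemma bij_betw_bilabellings_Un:
  assumes fin: "finite V" "finite W" and disj: "V \<inter> W = {}"
    and incomparable: "\<And>v w. v \<in> V \<Longrightarrow> w \<in> W \<Longrightarrow> \<not> prefix v w \<and> \<not> prefix w v"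
  shows "bij_betw (\<lambda>L. (\<Union>v\<in>V. L v, restrict L V, restrict L W)) (bilabellings (V \<union> W) A)
    (SIGMA C:{C. C \<subseteq> A \<and> card C = 2 * card V}. bilabellings V C \<times> bilabellings W (A - C))"
    (is "bij_betw ?f ?X ?Y")
proof -
  \<comment> \<open>The inverse glues the two labellings. Outside \<open>V \<union> W\<close> it
    falls through to \<open>M\<close>, which is \<open>undefined\<close> there by
    extensionality.\<close>
  let ?g = "\<lambda>(C :: nat set, K, M) v. if v \<in> V then K v else M v"
  have fX: "?f L \<in> ?Y" if L: "L \<in> ?X" for L
  proof -
    let ?C = "\<Union>v\<in>V. L v"
    have "?C \<subseteq> A" using bilabellingsD(4)[OF L] by blast
    moreover have "card ?C = 2 * card V" using card_label_set[OF L] fin by simp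
    moreover have "restrict L V \<in> bilabellings V ?C"
      using restrict_bilabelling[OF L] by simp
    moreover have "(\<Union>v\<in>W. L v) = A - ?C"
    proof -
      have "L v \<inter> L w = {}" if "v \<in> V" "w \<in> W" for v w
        using that disj bilabellingsD(3)[OF L, of v w] by blast
      moreover have "?C \<union> (\<Union>v\<in>W. L v) = A" using bilabellingsD(4)[OF L] by blast
      ultimately show ?thesis by blast
    qed
    then have "restrict L W \<in> bilabellings W (A - ?C)"
      using restrict_bilabelling[OF L, of W] by simp
    ultimately show ?thesis by simp
  qed
  have gY: "?g (C, K, M) \<in> ?X \<and> (\<Union>v\<in>V. ?g (C, K, M) v) = C"
    if C: "C \<subseteq> A" and K: "K \<in> bilabellings V C" and M: "M \<in> bilabellings W (A - C)" for C K M
  proof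
    let ?L = "?g (C, K, M)"
    have LV: "?L v = K v" if "v \<in> V" for v using that by simp
    have LW: "?L v = M v" if "v \<in> W" for v using that disj by auto
    show unV: "(\<Union>v\<in>V. ?L v) = C" using LV bilabellingsD(4)[OF K] by simp
    have unW: "(\<Union>v\<in>W. ?L v) = A - C" using LW bilabellingsD(4)[OF M] by simp
    show "?L \<in> ?X"
    proof (rule bilabellingsI)
      show "?L \<in> extensional (V \<union> W)"
        using bilabellingsD(1)[OF M] by (auto simp: extensional_def)
      show "card (?L v) = 2" if "v \<in> V \<union> W" for v
        using that LV LW bilabellingsD(2)[OF K] bilabellingsD(2)[OF M] by auto
      show "(\<Union>v\<in>V \<union> W. ?L v) = A"
        unfolding UN_Un unV unW using C by blast
      have mixed: "?L v \<inter> ?L w = {}" if "v \<in> V" "w \<in> W" for v w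
        using that unV unW by blast
      show "?L v \<inter> ?L w = {}" if vw: "v \<in> V \<union> W" "w \<in> V \<union> W" "v \<noteq> w" for v w
      proof -
        consider "v \<in> V" "w \<in> V" | "v \<in> V" "w \<in> W" | "v \<in> W" "w \<in> V" | "v \<in> W" "w \<in> W"
          using vw(1,2) by blast
        then show ?thesis
        proof cases
          case 1
          then show ?thesis using LV bilabellingsD(3)[OF K _ _ vw(3)] by simp
        next
          case 2
          then show ?thesis by (rule mixed)
        next
          case 3
          then show ?thesis using mixed[of w v] by blast
        next
          case 4
          then show ?thesis
            unfolding LW[OF 4(1)] LW[OF 4(2)] using bilabellingsD(3)[OF M _ _ vw(3)] by blast
        qed
      qed
      show "a < b" if vw: "v \<in> V \<union> W" "w \<in> V \<union> W" "strict_prefix v w" "a \<in> ?L v" "b \<in> ?L w"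
        for v w a b
      proof -
        consider "v \<in> V" "w \<in> V" | "v \<in> W" "w \<in> W"
          using vw(1-3) incomparable by (auto simp: strict_prefix_def)
        then show ?thesis
        proof cases
          case 1
          then show ?thesis using vw(4,5) bilabellingsD(5)[OF K 1 vw(3)] by simp
        next
          case 2
          then show ?thesis
            using vw(4,5) bilabellingsD(5)[OF M 2 vw(3)] unfolding LW[OF 2(1)] LW[OF 2(2)] by blast
        qed
      qed
    qed
  qed
  show ?thesis
  proof (rule bij_betw_byWitness[where f' = ?g])
    show "\<forall>L\<in>?X. ?g (?f L) = L"
    proof
      fix L assume "L \<in> ?X"
      then show "?g (?f L) = L"
        using bilabellingsD(1) by (fastforce simp: extensional_def fun_eq_iff)
    qed
    show "\<forall>y\<in>?Y. ?f (?g y) = y"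
    proof
      fix y assume "y \<in> ?Y"
      then obtain C K M where y: "y = (C, K, M)" "C \<subseteq> A"
        "K \<in> bilabellings V C" "M \<in> bilabellings W (A - C)" by blast
      have "restrict (?g (C, K, M)) V = K"
        using bilabellingsD(1)[OF y(3)] by (auto simp: extensional_def fun_eq_iff)
      moreover have "restrict (?g (C, K, M)) W = M"
        using bilabellingsD(1)[OF y(4)] disj by (auto simp: extensional_def fun_eq_iff)
      ultimately show "?f (?g y) = y" using gY[OF y(2-4)] y(1) by simp
    qed
    show "?f ` ?X \<subseteq> ?Y" using fX by blast
    show "?g ` ?Y \<subseteq> ?X"
    proof
      fix L assume "L \<in> ?g ` ?Y"
      then obtain C K M where "L = ?g (C, K, M)" "C \<subseteq> A"
        "K \<in> bilabellings V C" "M \<in> bilabellings W (A - C)" by blast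
      then show "L \<in> ?X" using gY[of C K M] by simp
    qed
  qed
qed

text \<open>Every extension of a list within the union lies in the same part, so no hook
  changes.\<close>

lemma hook_product_Un:
  assumes fin: "finite V" "finite W" and disj: "V \<inter> W = {}"
    and incomparable: "\<And>v w. v \<in> V \<Longrightarrow> w \<in> W \<Longrightarrow> \<not> prefix v w \<and> \<not> prefix w v"
  shows "hook_product (V \<union> W) = hook_product V * hook_product W"
proof -
  have "{w \<in> V \<union> W. prefix v w} = {w \<in> V. prefix v w}" if "v \<in> V" for v
    using that incomparable by blast
  moreover have "{w \<in> V \<union> W. prefix v w} = {w \<in> W. prefix v w}" if "v \<in> W" for v
    using that incomparable by blast
  ultimately show ?thesis
    unfolding hook_product_def prod.union_disjoint[OF fin disj] by simp
qed

section \<open>Removing a root\<close>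

lemma ex_two_smallest:
  fixes A :: "nat set"
  assumes "finite A" "card A \<ge> 2"
  obtains M where "M \<subseteq> A" "card M = 2" "\<And>a b. a \<in> M \<Longrightarrow> b \<in> A - M \<Longrightarrow> a < b"
proof -
  let ?x = "Min A" and ?y = "Min (A - {Min A})"
  have ne: "A \<noteq> {}" using assms by auto
  then have x: "?x \<in> A" using assms by simp
  then have "card (A - {?x}) \<ge> 1" using assms by simp
  then have "A - {?x} \<noteq> {}" by (metis card.empty not_one_le_zero)
  then have y: "?y \<in> A - {?x}" using assms(1) by (intro Min_in) auto
  have xy: "?x < ?y" using y assms(1) by (simp add: order.not_eq_order_implies_strict)
  have "?y \<le> b" if "b \<in> A - {?x, ?y}" for b using that assms(1) by (intro Min_le) auto
  then have yb: "?y < b" if "b \<in> A - {?x, ?y}" for b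
    using that by (metis Diff_iff insertCI order.not_eq_order_implies_strict)
  show thesis
  proof (rule that[of "{?x, ?y}"])
    show "{?x, ?y} \<subseteq> A" using x y by simp
    show "card {?x, ?y} = 2" using xy by simp
    show "a < b" if "a \<in> {?x, ?y}" "b \<in> A - {?x, ?y}" for a b
      using that yb[of b] xy by (metis empty_iff insert_iff order.strict_trans)
  qed
qed

text \<open>Two different finite sets of equal size each contain an element missing from the other;
  each of these two elements would have to be smaller than the other.\<close>

lemma smallest_subset_unique:
  fixes A :: "'a :: linorder set"
  assumes "finite A" "M \<subseteq> A" "N \<subseteq> A" "card M = card N"
    and M: "\<And>a b. a \<in> M \<Longrightarrow> b \<in> A - M \<Longrightarrow> a < b"
    and N: "\<And>a b. a \<in> N \<Longrightarrow> b \<in> A - N \<Longrightarrow> a < b"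
  shows "M = N"
proof (rule ccontr)
  assume ne: "M \<noteq> N"
  have fin: "finite M" "finite N" using assms finite_subset by blast+
  have "\<not> M \<subseteq> N" using card_subset_eq[of N M] fin assms(4) ne by blast
  moreover have "\<not> N \<subseteq> M" using card_subset_eq[of M N] fin assms(4) ne by auto
  ultimately obtain a b where "a \<in> M - N" "b \<in> N - M" by blast
  then show False using M[of a b] N[of b a] assms(2,3) by fastforce
qed

text \<open>Every other element lies strictly above \<open>r\<close>, so \<open>L r\<close> is a
  two-element initial segment of \<open>A\<close> and must be \<open>M\<close>. Restricting to
  \<open>V - {r}\<close> therefore loses no information.\<close>

lemma card_bilabellings_root:
  assumes fin: "finite V" "finite A" and r: "r \<in> V" and root: "\<And>v. v \<in> V \<Longrightarrow> prefix r v"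
    and M: "M \<subseteq> A" "card M = 2" "\<And>a b. a \<in> M \<Longrightarrow> b \<in> A - M \<Longrightarrow> a < b"
  shows "card (bilabellings V A) = card (bilabellings (V - {r}) (A - M))"
proof (rule bij_betw_same_card[where f = "\<lambda>L. restrict L (V - {r})"])
  have strict: "strict_prefix r v" if "v \<in> V - {r}" for v
    using that root by (auto simp: strict_prefix_def)
  have not_below: "\<not> strict_prefix v r" if "v \<in> V" for v
    using root[OF that] prefix_order.less_le_not_le by blast
  have label_root: "L r = M \<and> (\<Union>v\<in>V - {r}. L v) = A - M" if L: "L \<in> bilabellings V A" for L
  proof -
    have un: "L r \<union> (\<Union>v\<in>V - {r}. L v) = A" using bilabellingsD(4)[OF L] r by blast
    have "L r = M"
    proof (rule smallest_subset_unique[OF fin(2)])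
      show "L r \<subseteq> A" using un by blast
      show "card (L r) = card M" using bilabellingsD(2)[OF L r] M by simp
      fix a b assume ab: "a \<in> L r" "b \<in> A - L r"
      then obtain v where "v \<in> V - {r}" "b \<in> L v" using un by blast
      then show "a < b" using bilabellingsD(5)[OF L r, of v a b] strict ab by blast
    qed (use M in auto)
    moreover have "L r \<inter> L v = {}" if "v \<in> V - {r}" for v
      using bilabellingsD(3)[OF L r, of v] that by blast
    ultimately show ?thesis using un by blast
  qed
  show "bij_betw (\<lambda>L. restrict L (V - {r})) (bilabellings V A) (bilabellings (V - {r}) (A - M))"
  proof (rule bij_betw_byWitness[where f' = "\<lambda>K. K(r := M)"])
    show "\<forall>L\<in>bilabellings V A. (restrict L (V - {r}))(r := M) = L"
      using label_root bilabellingsD(1) by (fastforce simp: extensional_def fun_eq_iff)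
    show "\<forall>K\<in>bilabellings (V - {r}) (A - M). restrict (K(r := M)) (V - {r}) = K"
      using bilabellingsD(1) by (fastforce simp: extensional_def fun_eq_iff)
    show "(\<lambda>L. restrict L (V - {r})) ` bilabellings V A \<subseteq> bilabellings (V - {r}) (A - M)"
      using label_root restrict_bilabelling[of _ V A "V - {r}"] by auto
    show "(\<lambda>K. K(r := M)) ` bilabellings (V - {r}) (A - M) \<subseteq> bilabellings V A"
    proof (rule image_subsetI)
      fix K assume K: "K \<in> bilabellings (V - {r}) (A - M)"
      let ?L = "K(r := M)"
      have KA: "K v \<subseteq> A - M" if "v \<in> V" "v \<noteq> r" for v
        using that bilabellingsD(4)[OF K] by blast
      show "?L \<in> bilabellings V A"
      proof (rule bilabellingsI)
        show "?L \<in> extensional V"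
          using bilabellingsD(1)[OF K] r by (auto simp: extensional_def)
        show "card (?L v) = 2" if "v \<in> V" for v
          using that bilabellingsD(2)[OF K, of v] M by auto
        show "?L v \<inter> ?L w = {}" if "v \<in> V" "w \<in> V" "v \<noteq> w" for v w
          using that bilabellingsD(3)[OF K, of v w] KA[of v] KA[of w] by auto
        have "(\<Union>v\<in>V. ?L v) = M \<union> (\<Union>v\<in>V - {r}. K v)" using r by auto
        then show "(\<Union>v\<in>V. ?L v) = A" using bilabellingsD(4)[OF K] M(1) by auto
        show "a < b" if "v \<in> V" "w \<in> V" "strict_prefix v w" "a \<in> ?L v" "b \<in> ?L w" for v w a b
        proof -
          have w: "w \<noteq> r" using that not_below by blast
          show ?thesis
          proof (cases "v = r")
            case True
            then show ?thesis using that w KA[of w] M(3)[of a b] by auto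
          next
            case False
            then show ?thesis using that w bilabellingsD(5)[OF K, of v w a b] by auto
          qed
        qed
      qed
    qed
  qed
qed

text \<open>The hook of \<open>r\<close> is all of \<open>V\<close>, while \<open>r\<close> itself
  lies in no other hook.\<close>

lemma hook_product_root:
  assumes fin: "finite V" and r: "r \<in> V" and root: "\<And>v. v \<in> V \<Longrightarrow> prefix r v"
  shows "hook_product V = 2 * card V * (2 * card V - 1) * hook_product (V - {r})"
proof -
  have "{w \<in> V. prefix r w} = V" using root by blast
  moreover have "{w \<in> V. prefix v w} = {w \<in> V - {r}. prefix v w}" if "v \<in> V - {r}" for v
    using that root[of v] prefix_order.antisym by blast
  ultimately show ?thesis
    unfolding hook_product_def prod.remove[OF fin r] by simp
qed

section \<open>The hook-length formula for finite sets of lists\<close>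

text \<open>The induction on the size of \<open>V\<close> keeps \<open>A\<close> arbitrary, since
  the smaller sets are labelled from \<open>A - M\<close>, \<open>C\<close> and
  \<open>A - C\<close>. The product form avoids division of natural numbers.\<close>

lemma card_bilabellings:
  assumes "finite V" "finite A" "card A = 2 * card V"
  shows "card (bilabellings V A) * hook_product V = fact (2 * card V)"
  using assms
proof (induction "card V" arbitrary: V A rule: less_induct)
  case less
  show ?case
  proof (cases "V = {}")
    case True
    then have "bilabellings V A = {\<lambda>_. undefined}"
      using less.prems by (auto simp: bilabellings_def disjoint_family_on_def)
    then show ?thesis using True by (simp add: hook_product_def)
  next
    case False
    \<comment> \<open>Minimal length ensures that no element of \<open>V\<close> is a strict prefix
      of \<open>r\<close>; this is what makes \<open>W\<close> and the rest incomparable.\<close>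
    define r where "r = arg_min_on length V"
    have rV: "r \<in> V" and shortest: "\<And>v. v \<in> V \<Longrightarrow> length r \<le> length v"
      unfolding r_def using arg_min_if_finite[OF less.prems(1) False, of length]
      by (auto simp: not_less)
    define W where "W = {w \<in> V. prefix r w}"
    define U where "U = V - W"
    have V: "V = W \<union> U" and disj: "W \<inter> U = {}" unfolding W_def U_def by blast+
    have fin: "finite W" "finite U" using less.prems V by auto
    have card_V: "card V = card W + card U"
      using V disj fin by (simp add: card_Un_disjoint)
    have rW: "r \<in> W" using rV W_def by simp
    show ?thesis
    proof (cases "U = {}")
      case True
      then have root: "prefix r v" if "v \<in> V" for v using that V W_def by blast
      have pos: "card V > 0" using False less.prems by (simp add: card_gt_0_iff)
      then have "card A \<ge> 2" using less.prems by simp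
      then obtain M where M: "M \<subseteq> A" "card M = 2" "\<And>a b. a \<in> M \<Longrightarrow> b \<in> A - M \<Longrightarrow> a < b"
        using ex_two_smallest less.prems by metis
      have card': "card (V - {r}) = card V - 1" using rV less.prems by simp
      have "card (A - M) = 2 * card (V - {r})"
        using M less.prems card' finite_subset[OF M(1)] by (simp add: card_Diff_subset)
      then have IH: "card (bilabellings (V - {r}) (A - M)) * hook_product (V - {r})
          = fact (2 * card (V - {r}))"
        using less.hyps[of "V - {r}" "A - M"] less.prems card' pos by simp
      obtain k where k: "card V = Suc k" using pos by (cases "card V") auto
      have "card (bilabellings V A) * hook_product V
          = 2 * card V * (2 * card V - 1)
            * (card (bilabellings (V - {r}) (A - M)) * hook_product (V - {r}))"
        using card_bilabellings_root[OF less.prems(1,2) rV root M]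
          hook_product_root[OF less.prems(1) rV root]
        by simp
      also have "\<dots> = fact (2 * card V)"
        \<comment> \<open>With \<open>card V = Suc k\<close> this is
          \<open>(2k+2) * (2k+1) * (2k)! = (2k+2)!\<close>.\<close>
        unfolding IH card' k by (simp add: algebra_simps)
      finally show ?thesis .
    next
      case False
      have incomparable: "\<not> prefix v u \<and> \<not> prefix u v" if "v \<in> W" "u \<in> U" for v u
      proof
        have rv: "prefix r v" and ru: "\<not> prefix r u" and u: "u \<in> V"
          using that W_def U_def by auto
        show "\<not> prefix v u" using rv ru prefix_order.trans by blast
        \<comment> \<open>The forest property: two prefixes of \<open>v\<close> are comparable, and
          as \<open>r\<close> is no longer than \<open>u\<close>, it would be a prefix of
          \<open>u\<close>.\<close>
        show "\<not> prefix u v" using rv ru shortest[OF u] prefix_length_prefix by blast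
      qed
      have "card W < card V" "card U < card V"
        using card_V False rW fin by (auto simp: card_gt_0_iff)
      note IH = less.hyps[OF this(1) fin(1)] less.hyps[OF this(2) fin(2)]
      have hook_V: "hook_product V = hook_product W * hook_product U"
        unfolding V using fin disj incomparable by (rule hook_product_Un)
      let ?S = "{C. C \<subseteq> A \<and> card C = 2 * card W}"
      have S: "finite C" "finite (A - C)" "card C = 2 * card W" "card (A - C) = 2 * card U"
        if "C \<in> ?S" for C
      proof -
        show C: "finite C" "finite (A - C)" "card C = 2 * card W"
          using that less.prems finite_subset by auto
        show "card (A - C) = 2 * card U"
          using that C less.prems card_V by (simp add: card_Diff_subset)
      qed
      have "card (bilabellings V A)
          = card (SIGMA C:?S. bilabellings W C \<times> bilabellings U (A - C))"
        unfolding V using bij_betw_bilabellings_Un[OF fin disj incomparable]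
        by (intro bij_betw_same_card) blast
      also have "\<dots> = (\<Sum>C\<in>?S. card (bilabellings W C) * card (bilabellings U (A - C)))"
      proof (subst card_SigmaI)
        show "finite ?S" using less.prems(2) by simp
        show "\<forall>C\<in>?S. finite (bilabellings W C \<times> bilabellings U (A - C))"
          using S fin by (blast intro: finite_bilabellings)
      qed (simp only: card_cartesian_product)
      also have "\<dots> * hook_product V
          = (\<Sum>C\<in>?S. (card (bilabellings W C) * hook_product W)
                     * (card (bilabellings U (A - C)) * hook_product U))"
        unfolding sum_distrib_right hook_V by (intro sum.cong refl) (simp only: mult_ac)
      finally have "card (bilabellings V A) * hook_product V
          = (\<Sum>C\<in>?S. (card (bilabellings W C) * hook_product W)
                     * (card (bilabellings U (A - C)) * hook_product U))" .
      \<comment> \<open>By the induction hypotheses the summand does not depend on \<open>C\<close>,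
        so only the number of choices of \<open>C\<close>, a binomial coefficient, remains.\<close>
      also have "\<dots> = (\<Sum>C\<in>?S. fact (2 * card W) * fact (2 * card U))"
        using IH(1)[OF S(1,3)] IH(2)[OF S(2,4)] by (intro sum.cong refl) (simp only:)
      also have "\<dots> = fact (2 * card W) * fact (2 * card V - 2 * card W) * (2 * card V choose 2 * card W)"
        using n_subsets[OF less.prems(2)] less.prems(3) card_V by simp
      also have "\<dots> = fact (2 * card V)"
        by (rule binomial_fact_lemma) (use card_V in simp)
      finally show ?thesis .
    qed
  qed
qed

section \<open>From sets of lists back to ordered trees\<close>

text \<open>Node sets are closed under prefixes, so a path between two nodes stays inside the
  tree.\<close>

lemma is_node_append: "is_node t (p @ q) \<Longrightarrow> is_node t p"
  by (induction t p rule: is_node.induct) auto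

text \<open>
  Monotonicity along edges propagates along paths because no label set is empty.
\<close>

lemma increasing_bilabellings_eq:
  "increasing_bilabellings t = bilabellings (nodes t) {1..2 * card (nodes t)}"
proof -
  have "(\<forall>v\<in>nodes t. \<forall>w\<in>children t v. \<forall>a\<in>L v. \<forall>b\<in>L w. a < b) \<longleftrightarrow>
    (\<forall>v\<in>nodes t. \<forall>w\<in>nodes t. strict_prefix v w \<longrightarrow> (\<forall>a\<in>L v. \<forall>b\<in>L w. a < b))"
    (is "?edges \<longleftrightarrow> ?paths") if two: "\<forall>v\<in>nodes t. card (L v) = 2" for L :: "nat list \<Rightarrow> nat set"
  proof
    assume ?paths
    moreover have "strict_prefix v (v @ [i])" for v :: "nat list" and i
      by (simp add: strict_prefix_def)
    ultimately show ?edges unfolding children_def by blast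
  next
    assume edges: ?edges
    have path: "a < b" if "v \<in> nodes t" "a \<in> L v" "v @ p \<in> nodes t" "p \<noteq> []" "b \<in> L (v @ p)"
      for v p a b
      using that(3-5)
    \<comment> \<open>The path is extended at its lower end, where the last edge joins
      \<open>v @ p\<close> to its child. \<open>b\<close> varies because the hypothesis is applied
      to an intermediate label \<open>c\<close>.\<close>
    proof (induction p arbitrary: b rule: rev_induct)
      case (snoc i p)
      have vp: "v @ p \<in> nodes t"
        using snoc.prems(1) is_node_append[of t "v @ p" "[i]"] by (simp add: nodes_def)
      have "v @ p @ [i] \<in> children t (v @ p)"
        using snoc.prems(1) by (auto simp: children_def)
      then have edge: "c < b" if "c \<in> L (v @ p)" for c
        using edges vp that snoc.prems(3) by blast
      show ?case
      proof (cases "p = []")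
        case True
        then show ?thesis using edge \<open>a \<in> L v\<close> by simp
      next
        case False
        have "L (v @ p) \<noteq> {}" using two vp by force
        then obtain c where "c \<in> L (v @ p)" by blast
        then show ?thesis using edge snoc.IH[OF vp False] by fastforce
      qed
    qed simp
    show ?paths
    proof (intro ballI impI)
      fix v w a b
      assume *: "v \<in> nodes t" "w \<in> nodes t" "strict_prefix v w" "a \<in> L v" "b \<in> L w"
      from *(3) obtain i p where "w = v @ i # p" by (rule strict_prefixE')
      then show "a < b" using path[of v a "i # p" b] * by simp
    qed
  qed
  then show ?thesis unfolding increasing_bilabellings_def bilabellings_def by blast
qed

text \<open>This transfers the count to the reals; hooks are at least 1, so natural and real
  subtraction agree.\<close>

lemma increasing_bilabellings_hook_formula:
  "(\<Prod>v\<in>nodes t. 2 * real (hook_length t v) * (2 * real (hook_length t v) - 1))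
     * real (card (increasing_bilabellings t)) = fact (2 * card (nodes t))"
proof -
  have "hook_length t v \<ge> 1" if "v \<in> nodes t" for v
  proof -
    have "{w \<in> nodes t. prefix v w} \<noteq> {}" using that by blast
    then show ?thesis unfolding hook_length_def by (simp add: Suc_le_eq card_gt_0_iff finite_nodes)
  qed
  then have "real (hook_product (nodes t))
      = (\<Prod>v\<in>nodes t. 2 * real (hook_length t v) * (2 * real (hook_length t v) - 1))"
    unfolding hook_product_def hook_length_def[symmetric] of_nat_prod
    by (intro prod.cong) (auto simp: of_nat_diff)
  moreover have "card (increasing_bilabellings t) * hook_product (nodes t)
      = fact (2 * card (nodes t))"
    unfolding increasing_bilabellings_eq by (rule card_bilabellings) (simp_all add: finite_nodes)
  ultimately show ?thesis by (metis mult.commute of_nat_fact of_nat_mult)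
qed

theorem theorem2p3:
  fixes \<phi> :: "nat \<Rightarrow> real" and n :: nat
  assumes "\<And>j. \<phi> j \<ge> 0" and "\<phi> 0 > 0" and "n \<ge> 1"
  shows "(\<Sum>t\<in>ordered_trees n. \<Prod>v\<in>nodes t.
            \<phi> (outdeg t v) / (2 * real (hook_length t v) * (2 * real (hook_length t v) - 1)))
         = bilabelled_weight \<phi> n / fact (2 * n)"
  unfolding bilabelled_weight_def sum_divide_distrib
proof (rule sum.cong)
  fix t assume "t \<in> ordered_trees n"
  then have n: "card (nodes t) = n" by (simp add: ordered_trees_def)
  let ?H = "\<Prod>v\<in>nodes t. 2 * real (hook_length t v) * (2 * real (hook_length t v) - 1)"
  have H: "?H * real (card (increasing_bilabellings t)) = fact (2 * n)"
    using increasing_bilabellings_hook_formula[of t] n by simp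
  \<comment> \<open>A factorial is nonzero, so both factors are. Replacing
    \<open>fact (2 * n)\<close> by their product then lets the number of bilabellings
    cancel.\<close>
  then have "?H * real (card (increasing_bilabellings t)) \<noteq> 0"
    by (simp only: fact_nonzero not_False_eq_True)
  then have "?H \<noteq> 0" "real (card (increasing_bilabellings t)) \<noteq> 0"
    unfolding mult_eq_0_iff by blast+
  then show "(\<Prod>v\<in>nodes t. \<phi> (outdeg t v) / (2 * real (hook_length t v) * (2 * real (hook_length t v) - 1)))
      = (\<Prod>v\<in>nodes t. \<phi> (outdeg t v)) * real (card (increasing_bilabellings t)) / fact (2 * n)"
    unfolding H[symmetric] prod_dividef by simp
qed simp

end
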